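(* Let $F$ be a field of characteristic different from $2$ and let $L_3$ be the three-dimensional simple Lie algebra over $F$ with basis $\{e,f,g\}$ and multiplication $[e,f]=g$, $[f,g]=e$, $[g,e]=f$. Let $c(x,y_1,y_2,y_3)\in F\langle x,y_1,y_2,y_3\rangle$ be Formanek's central polynomial for $3\times 3$ matrices (defined in the context). Then $c(u,v_1,v_2,v_3)=0$ for all $u,v_1,v_2,v_3\in{\mathcal R}(L_3)$, while $c(x,y_1,y_2,y_3y_4)$ is a weak central polynomial (of degree $10$) for the pair $({\mathcal M}(L_3),{\mathcal R}(L_3))$.
   Context: ${\mathcal R}(L_3)=\mathrm{ad}(L_3)\subset\mathrm{End}_F(L_3)$ is the span of the operators $\mathrm{ad}(v):u\mapsto[u,v]$, $v\in L_3$, and ${\mathcal M}(L_3)$ is the associative subalgebra of $\mathrm{End}_F(L_3)$ generated by it. For an associative algebra $R$ generated by a subspace $V$, a polynomial in the free associative algebra is a weak (non-trivial) central polynomial for the pair $(R,V)$ if all its evaluations on elements of $V$ lie in the center of $R$ and at least one such evaluation is nonzero. Formanek's polynomial: let $\theta:F[u_1,u_2,u_3,u_4]\to F\langle x,y_1,y_2,y_3\rangle$ be the linear map sending the monomial $u_1^{n_1}u_2^{n_2}u_3^{n_3}u_4^{n_4}$ to $x^{n_1}y_1x^{n_2}y_2x^{n_3}y_3x^{n_4}$; write $\theta(p)(x,z_1,z_2,z_3)$ for the result of substituting $z_i$ for $y_i$ in $\theta(p)$. Let $p=(u_1-u_2)(u_1-u_3)(u_4-u_2)(u_4-u_3)(u_2-u_3)^2$.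 Then \[ c(x,y_1,y_2,y_3)=\theta(p)(x,y_1,y_2,y_3)+\theta(p)(x,y_2,y_3,y_1)+\theta(p)(x,y_3,y_1,y_2), \] which is a central polynomial for $M_3(F)$ over every field $F$. *)

theory Defs
  imports "HOL-Analysis.Cartesian_Space" "HOL-Library.Poly_Mapping"
begin

section \<open>Free associative algebras\<close>

datatype 'x word = Word (letters: "'x list")

instantiation word :: (type) monoid_add
begin
definition "0 = Word []"
definition "v + w = Word (letters v @ letters w)"
instance
  by standard (simp_all add: zero_word_def plus_word_def)
end

text \<open>With the library's convolution product, the finitely supported functions from the free
  monoid on \<open>'x\<close> to \<open>'a\<close> form the free associative algebra on \<open>'x\<close>.\<close>

type_synonym ('x, 'a) free_algebra = "'x word \<Rightarrow>\<^sub>0 'a"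

definition gen :: "'x \<Rightarrow> ('x, 'a::zero_neq_one) free_algebra"
  where "gen x = Poly_Mapping.single (Word [x]) 1"

definition free_scale :: "'a::field \<Rightarrow> ('x, 'a) free_algebra \<Rightarrow> ('x, 'a) free_algebra"
  where "free_scale c f = Poly_Mapping.map (\<lambda>a. c * a) f"

definition free_degree :: "('x, 'a::zero) free_algebra \<Rightarrow> nat"
  where "free_degree f =
    (if f = 0 then 0 else Max ((\<lambda>w. length (letters w)) ` Poly_Mapping.keys f))"

section \<open>Associative algebras and weak central polynomials\<close>

definition center_of :: "'b::ring_1 set \<Rightarrow> 'b set"
  where "center_of R = {z \<in> R. \<forall>r\<in>R. z * r = r * z}"

locale assoc_algebra = vector_space scale
  for scale :: "'a::field \<Rightarrow> 'b::ring_1 \<Rightarrow> 'b" +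
  assumes scale_mult_left: "scale c a * b = scale c (a * b)"
    and scale_mult_right: "a * scale c b = scale c (a * b)"
begin

definition subalgebra :: "'b set \<Rightarrow> bool"
  where "subalgebra S \<longleftrightarrow> subspace S \<and> (\<forall>a\<in>S. \<forall>b\<in>S. a * b \<in> S)"

definition generated_subalgebra :: "'b set \<Rightarrow> 'b set"
  where "generated_subalgebra V = subalgebra hull V"

definition eval :: "('x \<Rightarrow> 'b) \<Rightarrow> ('x, 'a) free_algebra \<Rightarrow> 'b"
  where "eval \<phi> f =
    (\<Sum>w\<in>Poly_Mapping.keys f. scale (Poly_Mapping.lookup f w) (prod_list (map \<phi> (letters w))))"

definition weak_central_polynomial :: "'b set \<Rightarrow> 'b set \<Rightarrow> ('x, 'a) free_algebra \<Rightarrow> bool"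
  where "weak_central_polynomial R V f \<longleftrightarrow>
    (\<forall>\<phi>. range \<phi> \<subseteq> V \<longrightarrow> eval \<phi> f \<in> center_of R) \<and>
    (\<exists>\<phi>. range \<phi> \<subseteq> V \<and> eval \<phi> f \<noteq> 0)"

end

lemma lookup_free_scale [simp]:
  "Poly_Mapping.lookup (free_scale c f) w = c * Poly_Mapping.lookup f w"
  by (simp add: free_scale_def Poly_Mapping.map.rep_eq when_def)

lemma free_scale_conv_mult: "free_scale c f = Poly_Mapping.single 0 c * f"
  unfolding free_scale_def by (rule mult_map_scale_conv_mult)

lemma single_zero_commute:
  fixes f :: "('x, 'a::field) free_algebra"
  shows "f * Poly_Mapping.single 0 c = Poly_Mapping.single 0 c * f"
proof -
  let ?s = "\<Sum>w\<in>Poly_Mapping.keys f. Poly_Mapping.single w (Poly_Mapping.lookup f w)"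
  have s: "?s = f"
    by (rule poly_mapping_eqI) (auto simp: lookup_sum lookup_single when_def in_keys_iff)
  have "?s * Poly_Mapping.single 0 c = Poly_Mapping.single 0 c * ?s"
    by (simp add: sum_distrib_left sum_distrib_right mult_single mult.commute)
  then show ?thesis
    by (simp only: s)
qed

interpretation free: assoc_algebra "free_scale :: 'a::field \<Rightarrow> ('x, 'a) free_algebra \<Rightarrow> _"
proof
  fix c d :: 'a and f g :: "('x, 'a) free_algebra"
  show "free_scale c (f + g) = free_scale c f + free_scale c g"
    by (simp add: free_scale_conv_mult distrib_left)
  show "free_scale (c + d) f = free_scale c f + free_scale d f"
    by (simp add: free_scale_conv_mult single_add distrib_right)
  show "free_scale c (free_scale d f) = free_scale (c * d) f"
    by (simp add: free_scale_conv_mult mult_single flip: mult.assoc)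
  show "free_scale 1 f = f"
    by (simp add: free_scale_conv_mult)
  show "free_scale c f * g = free_scale c (f * g)"
    by (simp add: free_scale_conv_mult mult.assoc)
  show "f * free_scale c g = free_scale c (f * g)"
    by (simp add: free_scale_conv_mult single_zero_commute flip: mult.assoc)
qed

section \<open>The algebra of linear endomorphisms\<close>

typedef (overloaded) ('a, 'n) endo =
  "{f :: 'a::field ^ 'n::finite \<Rightarrow> 'a ^ 'n. Vector_Spaces.linear vector_scalar_mult vector_scalar_mult f}"
  using vec.linear_id by blast

setup_lifting type_definition_endo

instantiation endo :: (field, finite) ring_1
begin

lift_definition zero_endo :: "('a, 'b) endo" is "\<lambda>v. 0"
  by (rule vec.linear_zero)
lift_definition one_endo :: "('a, 'b) endo" is "\<lambda>v. v"
  by (rule vec.linear_ident)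
lift_definition plus_endo :: "('a, 'b) endo \<Rightarrow> ('a, 'b) endo \<Rightarrow> ('a, 'b) endo"
  is "\<lambda>f g v. f v + g v"
  by (rule vec.linear_compose_add)
lift_definition uminus_endo :: "('a, 'b) endo \<Rightarrow> ('a, 'b) endo" is "\<lambda>f v. - f v"
  by (rule vec.linear_compose_neg)
lift_definition minus_endo :: "('a, 'b) endo \<Rightarrow> ('a, 'b) endo \<Rightarrow> ('a, 'b) endo"
  is "\<lambda>f g v. f v - g v"
  by (rule vec.linear_compose_sub)
lift_definition times_endo :: "('a, 'b) endo \<Rightarrow> ('a, 'b) endo \<Rightarrow> ('a, 'b) endo"
  is "\<lambda>f g. f \<circ> g"
  by (rule Vector_Spaces.linear_compose)

instance
proof
  show "(0 :: ('a, 'b) endo) \<noteq> 1"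
    by transfer (metis one_neq_zero vec_eq_iff one_index zero_index)
qed (transfer; force simp: fun_eq_iff vec.linear_add)+

end

lift_definition endo_scale :: "'a::field \<Rightarrow> ('a, 'n::finite) endo \<Rightarrow> ('a, 'n) endo"
  is "\<lambda>c f v. c *s f v"
  by (rule vec.linear_compose_scale_right)

interpretation endo: assoc_algebra "endo_scale :: 'a::field \<Rightarrow> ('a, 'n::finite) endo \<Rightarrow> _"
  by standard
    (transfer; force simp: fun_eq_iff vec.scale_right_distrib vec.scale_left_distrib vec.linear_scale)+

section \<open>The Lie algebra \<open>L\<^sub>3\<close>\<close>

text \<open>\<open>L\<^sub>3\<close> is realised on \<open>F\<^sup>3\<close>, with \<open>e\<close>, \<open>f\<close>, \<open>g\<close> the standard basis.\<close>

definition L3_bracket :: "'a::field ^ 3 \<Rightarrow> 'a ^ 3 \<Rightarrow> 'a ^ 3"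
  where "L3_bracket u v = vector
    [u$2 * v$3 - u$3 * v$2, u$3 * v$1 - u$1 * v$3, u$1 * v$2 - u$2 * v$1]"

lemma L3_bracket_basis:
  "L3_bracket (axis 1 1) (axis 2 1) = axis 3 1"
  "L3_bracket (axis 2 1) (axis 3 1) = axis 1 1"
  "L3_bracket (axis 3 1) (axis 1 1) = axis 2 1"
  by (simp_all add: L3_bracket_def vec_eq_iff forall_3 axis_def)

lemma L3_bracket_linear_left: "Vector_Spaces.linear vector_scalar_mult vector_scalar_mult (\<lambda>u. L3_bracket u v)"
  by unfold_locales (simp_all add: L3_bracket_def vec_eq_iff forall_3 algebra_simps)

lemma L3_bracket_linear_right: "Vector_Spaces.linear vector_scalar_mult vector_scalar_mult (\<lambda>v. L3_bracket u v)"
  by unfold_locales (simp_all add: L3_bracket_def vec_eq_iff forall_3 algebra_simps)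

lemma L3_bracket_self: "L3_bracket u u = 0"
  by (simp add: L3_bracket_def vec_eq_iff forall_3)

lemma L3_bracket_jacobi:
  "L3_bracket u (L3_bracket v w) + L3_bracket v (L3_bracket w u) + L3_bracket w (L3_bracket u v) = 0"
  by (simp add: L3_bracket_def vec_eq_iff forall_3 algebra_simps)

lift_definition L3_ad :: "'a::field ^ 3 \<Rightarrow> ('a, 3) endo" is "\<lambda>v u. L3_bracket u v"
  by (rule L3_bracket_linear_left)

definition R_L3 :: "('a::field, 3) endo set"
  where "R_L3 = endo.span (range L3_ad)"

text \<open>No unit is adjoined here, but the identity lies in the span of the products of operators
  in \<open>R_L3\<close>, so the unital reading gives the same algebra.\<close>

definition M_L3 :: "('a::field, 3) endo set"
  where "M_L3 = endo.generated_subalgebra R_L3"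

section \<open>Formanek's polynomial\<close>

datatype uvar = U1 | U2 | U3 | U4
datatype var4 = X | Y1 | Y2 | Y3
datatype var5 = X' | Y1' | Y2' | Y3' | Y4'

fun assign :: "'b \<Rightarrow> 'b \<Rightarrow> 'b \<Rightarrow> 'b \<Rightarrow> var4 \<Rightarrow> 'b" where
  "assign x y1 y2 y3 X = x"
| "assign x y1 y2 y3 Y1 = y1"
| "assign x y1 y2 y3 Y2 = y2"
| "assign x y1 y2 y3 Y3 = y3"

text \<open>The polynomial ring \<open>F[u\<^sub>1, u\<^sub>2, u\<^sub>3, u\<^sub>4]\<close> is the type \<open>(uvar \<Rightarrow>\<^sub>0 nat) \<Rightarrow>\<^sub>0 'a\<close>.\<close>

definition pvar :: "uvar \<Rightarrow> (uvar \<Rightarrow>\<^sub>0 nat) \<Rightarrow>\<^sub>0 'a::field"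
  where "pvar i = Poly_Mapping.single (Poly_Mapping.single i 1) 1"

definition formanek_theta :: "((uvar \<Rightarrow>\<^sub>0 nat) \<Rightarrow>\<^sub>0 'a::field) \<Rightarrow> (var4, 'a) free_algebra"
  where "formanek_theta q = (\<Sum>m\<in>Poly_Mapping.keys q. free_scale (Poly_Mapping.lookup q m)
    (gen X ^ Poly_Mapping.lookup m U1 * gen Y1 * gen X ^ Poly_Mapping.lookup m U2 * gen Y2 *
     gen X ^ Poly_Mapping.lookup m U3 * gen Y3 * gen X ^ Poly_Mapping.lookup m U4))"

definition formanek_p :: "(uvar \<Rightarrow>\<^sub>0 nat) \<Rightarrow>\<^sub>0 'a::field"
  where "formanek_p =
    (pvar U1 - pvar U2) * (pvar U1 - pvar U3) * (pvar U4 - pvar U2) * (pvar U4 - pvar U3) *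
    (pvar U2 - pvar U3)\<^sup>2"

definition formanek_c :: "(var4, 'a::field) free_algebra"
  where "formanek_c =
    free.eval (assign (gen X) (gen Y1) (gen Y2) (gen Y3)) (formanek_theta formanek_p) +
    free.eval (assign (gen X) (gen Y2) (gen Y3) (gen Y1)) (formanek_theta formanek_p) +
    free.eval (assign (gen X) (gen Y3) (gen Y1) (gen Y2)) (formanek_theta formanek_p)"

text \<open>The polynomial \<open>c(x, y\<^sub>1, y\<^sub>2, y\<^sub>3y\<^sub>4)\<close>.\<close>

definition formanek_c_subst :: "(var5, 'a::field) free_algebra"
  where "formanek_c_subst =
    free.eval (assign (gen X') (gen Y1') (gen Y2') (gen Y3' * gen Y4')) formanek_c"

end

(*
  Multiplying by u_i - u_j for neighbouring i, j amounts to replacing the y between two powers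
  of x by its commutator with x. Expanding only the remaining factors (u1 - u3)(u4 - u2) of p,
  one gets theta(p) as a combination of four words in x, A = [x, y1], B = [x, [x, y2]] and
  C = -[x, y3]. For x = ad u, y1 = ad v the commutator is ad of [v, u], which is
  orthogonal to u; for such A, B, C one has xAx = xBx = xCx = 0 and xABCx = 0, so theta(p) vanishes
  on R(L3). On (ad u, ad v1, ad v2, ad v3 ad v4) the value of c is a scalar operator, the scalar
  being -2 (u.u) times a quadrilinear form in the vectors [vi, u].
*)
theory Submission
  imports Defs
begin

section \<open>Evaluation homomorphisms\<close>

text \<open>Both the words of the free algebra and the monomials in the \<open>u_i\<close> are
  indices of finitely supported functions, so additive claims about either reduce to one
  term.\<close>

lemma poly_mapping_induct_single_add [case_names zero single add]:
  assumes "P 0"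
    and "\<And>k v. P (Poly_Mapping.single k v)"
    and "\<And>f g. P f \<Longrightarrow> P g \<Longrightarrow> P (f + g)"
  shows "P (f :: 'k \<Rightarrow>\<^sub>0 'v::comm_monoid_add)"
proof -
  have "P (\<Sum>k\<in>A. Poly_Mapping.single k (Poly_Mapping.lookup f k))" for A
    by (induction A rule: infinite_finite_induct) (use assms in auto)
  moreover have "(\<Sum>k\<in>Poly_Mapping.keys f. Poly_Mapping.single k (Poly_Mapping.lookup f k)) = f"
    by (rule poly_mapping_eqI) (auto simp: lookup_sum lookup_single when_def in_keys_iff)
  ultimately show ?thesis
    by metis
qed

lemma (in assoc_algebra) sum_lookup_superset:
  assumes "finite K" and "Poly_Mapping.keys f \<subseteq> K"
  shows "(\<Sum>k\<in>Poly_Mapping.keys f. scale (Poly_Mapping.lookup f k) (h k)) =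
    (\<Sum>k\<in>K. scale (Poly_Mapping.lookup f k) (h k))"
  using assms by (intro sum.mono_neutral_left) (auto simp: in_keys_iff)

text \<open>With \<open>h\<close> arbitrary this yields the additivity of evaluation and of theta
  alike. Keys lost by cancellation in \<open>f + g\<close> carry coefficient 0.\<close>

lemma (in assoc_algebra) sum_lookup_add:
  "(\<Sum>k\<in>Poly_Mapping.keys (f + g). scale (Poly_Mapping.lookup (f + g) k) (h k)) =
    (\<Sum>k\<in>Poly_Mapping.keys f. scale (Poly_Mapping.lookup f k) (h k)) +
    (\<Sum>k\<in>Poly_Mapping.keys g. scale (Poly_Mapping.lookup g k) (h k))"
proof -
  let ?K = "Poly_Mapping.keys f \<union> Poly_Mapping.keys g"
  show ?thesis
    using sum_lookup_superset[of ?K f h] sum_lookup_superset[of ?K g h]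
      sum_lookup_superset[of ?K "f + g" h] keys_add[of f g]
    by (simp add: lookup_add scale_left_distrib sum.distrib)
qed

lemma (in assoc_algebra) sum_lookup_single:
  "(\<Sum>k\<in>Poly_Mapping.keys (Poly_Mapping.single m c).
      scale (Poly_Mapping.lookup (Poly_Mapping.single m c) k) (h k)) = scale c (h m)"
  using sum_lookup_superset[of "{m}" "Poly_Mapping.single m c" h] by simp

context assoc_algebra
begin

lemma eval_zero [simp]: "eval \<phi> 0 = 0"
  by (simp add: eval_def)

lemma eval_single: "eval \<phi> (Poly_Mapping.single w c) = scale c (prod_list (map \<phi> (letters w)))"
  unfolding eval_def by (rule sum_lookup_single)

lemma eval_add: "eval \<phi> (f + g) = eval \<phi> f + eval \<phi> g"
  unfolding eval_def by (rule sum_lookup_add)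

lemma eval_mult: "eval \<phi> (f * g) = eval \<phi> f * eval \<phi> g"
proof (induction f rule: poly_mapping_induct_single_add)
  case (single w c)
  show ?case
  proof (induction g rule: poly_mapping_induct_single_add)
    case (single w' c')
    show ?case
      by (simp add: mult_single eval_single plus_word_def scale_mult_left scale_mult_right)
  qed (simp_all add: eval_add distrib_left)
qed (simp_all add: eval_add distrib_right)

lemma eval_one [simp]: "eval \<phi> 1 = 1"
  by (simp add: eval_single zero_word_def flip: single_one)

lemma eval_gen [simp]: "eval \<phi> (gen x) = \<phi> x"
  by (simp add: gen_def eval_single)

lemma eval_power: "eval \<phi> (f ^ n) = eval \<phi> f ^ n"
  by (induction n) (simp_all add: eval_mult)

lemma eval_scale: "eval \<phi> (free_scale c f) = scale c (eval \<phi> f)"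
  by (simp add: free_scale_conv_mult eval_mult eval_single zero_word_def scale_mult_left)

lemma eval_prod_list: "eval \<phi> (prod_list fs) = prod_list (map (eval \<phi>) fs)"
  by (induction fs) (simp_all add: eval_mult)

lemma eval_eval: "eval \<phi> (free.eval \<sigma> f) = eval (\<lambda>x. eval \<phi> (\<sigma> x)) f"
  by (induction f rule: poly_mapping_induct_single_add)
    (simp_all add: free.eval_zero free.eval_single eval_single free.eval_add eval_add eval_scale eval_prod_list
      comp_def)

end

section \<open>Formanek's polynomial in terms of commutators\<close>

lemma (in assoc_algebra) eval_assign:
  "(\<lambda>v. eval \<phi> (assign a b c d v)) = assign (eval \<phi> a) (eval \<phi> b) (eval \<phi> c) (eval \<phi> d)"
proof
  show "eval \<phi> (assign a b c d v) = assign (eval \<phi> a) (eval \<phi> b) (eval \<phi> c) (eval \<phi> d) v" for v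
    by (cases v) simp_all
qed

text \<open>The outer difference comes from the factor u1 - u3 of p, the two inner ones from u4 -
  u2.\<close>

definition formanek_term :: "'b::ring_1 \<Rightarrow> 'b \<Rightarrow> 'b \<Rightarrow> 'b \<Rightarrow> 'b"
  where "formanek_term x y1 y2 y3 =
    (let A = x * y1 - y1 * x; D = x * y2 - y2 * x; B = x * D - D * x; C = y3 * x - x * y3
     in x * (A * B * C * x - A * (x * B) * C) - (A * (B * x) * C * x - A * (x * (B * x)) * C))"

definition formanek_value :: "'b::ring_1 \<Rightarrow> 'b \<Rightarrow> 'b \<Rightarrow> 'b \<Rightarrow> 'b"
  where "formanek_value x y1 y2 y3 =
    formanek_term x y1 y2 y3 + formanek_term x y2 y3 y1 + formanek_term x y3 y1 y2"

section \<open>Linear factors of p acting on theta\<close>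

context assoc_algebra
begin

text \<open>The \<open>y_i\<close> range over the whole algebra, so that a factor of
  \<open>q\<close> can be traded for a new argument such as a commutator.\<close>

definition theta_value :: "'b \<Rightarrow> 'b \<Rightarrow> 'b \<Rightarrow> 'b \<Rightarrow> ((uvar \<Rightarrow>\<^sub>0 nat) \<Rightarrow>\<^sub>0 'a) \<Rightarrow> 'b"
  where "theta_value x y1 y2 y3 q = eval (assign x y1 y2 y3) (formanek_theta q)"

lemma theta_value_zero [simp]: "theta_value x y1 y2 y3 0 = 0"
  by (simp add: theta_value_def formanek_theta_def)

lemma theta_value_add:
  "theta_value x y1 y2 y3 (q + r) = theta_value x y1 y2 y3 q + theta_value x y1 y2 y3 r"
  unfolding theta_value_def formanek_theta_def free.sum_lookup_add eval_add ..

lemma theta_value_diff: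
  "theta_value x y1 y2 y3 (q - r) = theta_value x y1 y2 y3 q - theta_value x y1 y2 y3 r"
  using theta_value_add[of x y1 y2 y3 "q - r" r] by (simp add: algebra_simps)

lemma theta_value_single:
  "theta_value x y1 y2 y3 (Poly_Mapping.single m c) =
    scale c (x ^ Poly_Mapping.lookup m U1 * y1 * x ^ Poly_Mapping.lookup m U2 * y2 *
      x ^ Poly_Mapping.lookup m U3 * y3 * x ^ Poly_Mapping.lookup m U4)"
  unfolding theta_value_def formanek_theta_def free.sum_lookup_single
  by (simp add: eval_scale eval_mult eval_power)

lemma theta_value_one: "theta_value x y1 y2 y3 1 = y1 * y2 * y3"
  using theta_value_single[of x y1 y2 y3 0 1] by simp

lemma power_left_commutes: "x ^ n * (x * y) = x * (x ^ n * y)" for x y :: "'r::monoid_mult"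
  by (simp add: power_commutes flip: mult.assoc)

lemmas theta_value_expand =
  theta_value_single theta_value_add theta_value_diff pvar_def mult_single lookup_add lookup_single
  left_diff_distrib right_diff_distrib distrib_left distrib_right
  scale_right_diff_distrib scale_right_distrib scale_mult_left scale_mult_right
  mult.assoc power_commutes power_left_commutes

text \<open>On a monomial, u1 adds an x directly to the left of \<open>y1\<close> and u2 one
  directly to its right; both can be absorbed into \<open>y1\<close>.\<close>

lemma theta_value_U1_U2:
  "theta_value x y1 y2 y3 ((pvar U1 - pvar U2) * q) = theta_value x (x * y1 - y1 * x) y2 y3 q"
  by (induction q rule: poly_mapping_induct_single_add) (simp_all add: theta_value_expand)

lemma theta_value_U2_U3:
  "theta_value x y1 y2 y3 ((pvar U2 - pvar U3) * q) = theta_value x y1 (x * y2 - y2 * x) y3 q"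
  by (induction q rule: poly_mapping_induct_single_add) (simp_all add: theta_value_expand)

lemma theta_value_U4_U3:
  "theta_value x y1 y2 y3 ((pvar U4 - pvar U3) * q) = theta_value x y1 y2 (y3 * x - x * y3) q"
  by (induction q rule: poly_mapping_induct_single_add) (simp_all add: theta_value_expand)

text \<open>Here u1 adds an x at the left end of the word, while u3 adds one just after
  \<open>y2\<close>: no single argument absorbs both.\<close>

lemma theta_value_U1_U3:
  "theta_value x y1 y2 y3 ((pvar U1 - pvar U3) * q) =
    x * theta_value x y1 y2 y3 q - theta_value x y1 (y2 * x) y3 q"
  by (induction q rule: poly_mapping_induct_single_add) (simp_all add: theta_value_expand)

lemma theta_value_U4_U2:
  "theta_value x y1 y2 y3 ((pvar U4 - pvar U2) * q) =
    theta_value x y1 y2 y3 q * x - theta_value x y1 (x * y2) y3 q"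
  by (induction q rule: poly_mapping_induct_single_add) (simp_all add: theta_value_expand)

lemma theta_value_formanek_p: "theta_value x y1 y2 y3 formanek_p = formanek_term x y1 y2 y3"
proof -
  \<comment> \<open>Factors are removed from the outside in: first those that build A, C and B, then
    the two that produce the four words. The final 1 leaves the plain product of the
    arguments.\<close>
  have "formanek_p = (pvar U1 - pvar U2) * ((pvar U4 - pvar U3) * ((pvar U2 - pvar U3) *
      ((pvar U2 - pvar U3) * ((pvar U1 - pvar U3) * ((pvar U4 - pvar U2) * 1)))))"
    unfolding formanek_p_def power2_eq_square by (simp only: mult_ac mult_1_left mult_1_right)
  show ?thesis
    unfolding \<open>formanek_p = _\<close>
    by (simp only: theta_value_U1_U2 theta_value_U2_U3 theta_value_U4_U3 theta_value_U1_U3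
        theta_value_U4_U2 theta_value_one formanek_term_def Let_def)
qed

lemma eval_formanek_c: "eval (assign x y1 y2 y3) formanek_c = formanek_value x y1 y2 y3"
  by (simp add: formanek_c_def eval_add eval_eval eval_assign formanek_value_def
      flip: theta_value_formanek_p theta_value_def)

lemma eval_formanek_c_subst:
  "eval \<phi> formanek_c_subst =
    formanek_value (\<phi> X') (\<phi> Y1') (\<phi> Y2') (\<phi> Y3' * \<phi> Y4')"
  by (simp add: formanek_c_subst_def eval_eval eval_assign eval_mult eval_formanek_c)

end

section \<open>The degree\<close>

text \<open>Zero is homogeneous of every degree, so cancellation in sums does no harm.\<close>

definition homogeneous :: "nat \<Rightarrow> ('x, 'a::zero) free_algebra \<Rightarrow> bool"
  where "homogeneous n f \<longleftrightarrow> (\<forall>w\<in>Poly_Mapping.keys f. length (letters w) = n)"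

lemma homogeneous_gen: "homogeneous 1 (gen x :: ('x, 'a::zero_neq_one) free_algebra)"
  by (simp add: homogeneous_def gen_def)

lemma homogeneous_add: "homogeneous n f \<Longrightarrow> homogeneous n g \<Longrightarrow> homogeneous n (f + g)"
  using keys_add[of f g] unfolding homogeneous_def by blast

lemma homogeneous_diff:
  fixes f g :: "('x, 'a::ab_group_add) free_algebra"
  shows "homogeneous n f \<Longrightarrow> homogeneous n g \<Longrightarrow> homogeneous n (f - g)"
  using keys_diff[of f g] unfolding homogeneous_def by blast

lemma homogeneous_mult:
  assumes "homogeneous m f" and "homogeneous n g"
  shows "homogeneous (m + n) (f * g)"
  using keys_mult[of f g] assms unfolding homogeneous_def by (fastforce simp: plus_word_def)

text \<open>The 6 is the degree of p, the number of x in each word. Separate degrees for the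
  \<open>y_i\<close> admit a product as argument; 6 + 1 + 1 + 2 gives the degree 10.\<close>

lemma homogeneous_formanek_term:
  fixes x y1 y2 y3 :: "('x, 'a::field) free_algebra"
  assumes x: "homogeneous 1 x"
    and y: "homogeneous d1 y1" "homogeneous d2 y2" "homogeneous d3 y3"
  shows "homogeneous (6 + d1 + d2 + d3) (formanek_term x y1 y2 y3)"
proof -
  have comm: "homogeneous (Suc d) (x * y - y * x)" if "homogeneous d y" for d y
    using homogeneous_diff homogeneous_mult[OF x that] homogeneous_mult[OF that x] by auto
  have comm': "homogeneous (Suc d) (y * x - x * y)" if "homogeneous d y" for d y
    using homogeneous_diff homogeneous_mult[OF x that] homogeneous_mult[OF that x] by auto
  have *: "homogeneous (6 + d1 + d2 + d3) (x * (A * B * C * x - A * (x * B) * C) -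
      (A * (B * x) * C * x - A * (x * (B * x)) * C))"
    if A: "homogeneous (Suc d1) A" and B: "homogeneous (Suc (Suc d2)) B"
      and C: "homogeneous (Suc d3) C" for A B C
  proof -
    note m = homogeneous_mult
    show ?thesis
      using m[OF x homogeneous_diff[OF m[OF m[OF m[OF A B] C] x]]] m[OF m[OF A m[OF x B]] C]
        m[OF m[OF m[OF A m[OF B x]] C] x] m[OF m[OF A m[OF x m[OF B x]]] C]
      by (intro homogeneous_diff) (simp_all add: add_ac eval_nat_numeral)
  qed
  show ?thesis
    unfolding formanek_term_def Let_def by (intro * comm comm' y)
qed

lemma homogeneous_formanek_c_subst:
  "homogeneous 10 (formanek_c_subst :: (var5, 'a::field) free_algebra)"
proof -
  have "homogeneous 2 (gen Y3' * gen Y4' :: (var5, 'a) free_algebra)"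
    using homogeneous_mult[OF homogeneous_gen homogeneous_gen] by (simp add: numeral_2_eq_2)
  note terms =
    homogeneous_formanek_term[OF homogeneous_gen homogeneous_gen homogeneous_gen this]
    homogeneous_formanek_term[OF homogeneous_gen homogeneous_gen this homogeneous_gen]
    homogeneous_formanek_term[OF homogeneous_gen this homogeneous_gen homogeneous_gen]
  show ?thesis
    unfolding formanek_c_subst_def free.eval_formanek_c formanek_value_def
    using terms by (intro homogeneous_add) simp_all
qed

lemma homogeneous_imp_free_degree:
  assumes "homogeneous n f" and "f \<noteq> 0"
  shows "free_degree f = n"
proof -
  have "(\<lambda>w. length (letters w)) ` Poly_Mapping.keys f = {n}"
    using assms keys_eq_empty[of f] by (fastforce simp: homogeneous_def)
  then show ?thesis
    using assms by (simp add: free_degree_def)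
qed

section \<open>Operators on \<open>L\<^sub>3\<close>\<close>

lift_definition endo_apply :: "('a::field, 'n::finite) endo \<Rightarrow> 'a ^ 'n \<Rightarrow> 'a ^ 'n" is "\<lambda>f. f" .

lemma endo_eqI: "(\<And>w. endo_apply E w = endo_apply G w) \<Longrightarrow> E = G"
  by transfer auto

lemma endo_apply_simps [simp]:
  "endo_apply 0 w = 0"
  "endo_apply 1 w = w"
  "endo_apply (E + G) w = endo_apply E w + endo_apply G w"
  "endo_apply (E - G) w = endo_apply E w - endo_apply G w"
  "endo_apply (- E) w = - endo_apply E w"
  "endo_apply (E * G) w = endo_apply E (endo_apply G w)"
  "endo_apply (endo_scale c E) w = c *s endo_apply E w"
  by (transfer; simp)+

lemma endo_apply_ad [simp]: "endo_apply (L3_ad v) w = L3_bracket w v"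
  by transfer simp

lemmas L3_coordinates = L3_bracket_def vec_eq_iff forall_3 vector_3 vector_add_component
  vector_minus_component vector_smult_component zero_index

text \<open>Since ad is linear, its image is already a subspace, and every element of the span is a
  single ad v.\<close>

lemma R_L3_eq: "R_L3 = range (L3_ad :: 'a::field ^ 3 \<Rightarrow> _)"
proof -
  have "endo.subspace (range (L3_ad :: 'a ^ 3 \<Rightarrow> _))"
    unfolding endo.subspace_def
  proof (intro conjI ballI allI)
    have "L3_ad 0 = (0 :: ('a, 3) endo)"
      by (rule endo_eqI) (simp add: L3_coordinates)
    then show "0 \<in> range (L3_ad :: 'a ^ 3 \<Rightarrow> _)"
      by (metis rangeI)
  next
    fix E G :: "('a, 3) endo"
    assume "E \<in> range L3_ad" "G \<in> range L3_ad"
    then obtain u v where "E = L3_ad u" "G = L3_ad v"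
      by auto
    then have "E + G = L3_ad (u + v)"
      by (intro endo_eqI) (simp add: L3_coordinates algebra_simps)
    then show "E + G \<in> range L3_ad"
      by simp
  next
    fix c and E :: "('a, 3) endo"
    assume "E \<in> range L3_ad"
    then obtain u where "E = L3_ad u"
      by auto
    then have "endo_scale c E = L3_ad (c *s u)"
      by (intro endo_eqI) (simp add: L3_coordinates algebra_simps)
    then show "endo_scale c E \<in> range L3_ad"
      by simp
  qed
  then show ?thesis
    unfolding R_L3_def by (simp add: endo.span_eq_iff)
qed

text \<open>This is the Jacobi identity. The order is reversed because \<open>L3_ad v\<close>
  brackets with v on the right.\<close>

lemma ad_commutator: "L3_ad u * L3_ad v - L3_ad v * L3_ad u = L3_ad (L3_bracket v u)"
  by (rule endo_eqI) (simp add: L3_coordinates algebra_simps)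

text \<open>The invariant form for which e, f, g are orthonormal; \<open>L3_bracket\<close> is the
  cross product.\<close>

definition dot :: "'a::field ^ 3 \<Rightarrow> 'a ^ 3 \<Rightarrow> 'a"
  where "dot p q = p$1 * q$1 + p$2 * q$2 + p$3 * q$3"

section \<open>Values of Formanek's polynomial on ad operators\<close>

lemma formanek_term_ad: "formanek_term (L3_ad u) (L3_ad y1) (L3_ad y2) (L3_ad y3) = 0"
proof (rule endo_eqI)
  fix w :: "'a::field ^ 3"
  show "endo_apply (formanek_term (L3_ad u) (L3_ad y1) (L3_ad y2) (L3_ad y3)) w = endo_apply 0 w"
    \<comment> \<open>With the commutators collapsed to ad of brackets, each coordinate is a
      polynomial identity. Each of the four words vanishes: xABCx itself, the others by containing
      xAx, xBx or xCx.\<close>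
    unfolding formanek_term_def Let_def ad_commutator endo_apply_simps endo_apply_ad L3_coordinates
    by (intro conjI; algebra)
qed

lemma formanek_value_ad: "formanek_value (L3_ad u) (L3_ad v1) (L3_ad v2) (L3_ad v3) = 0"
  by (simp add: formanek_value_def formanek_term_ad)

text \<open>Commutation with ad u is a derivation. A product of two ad operators need not be an ad
  operator, so \<open>ad_commutator\<close> alone does not cover it.\<close>

lemma ad_commutator_product:
  "L3_ad u * (L3_ad v * L3_ad w) - L3_ad v * L3_ad w * L3_ad u =
    L3_ad (L3_bracket v u) * L3_ad w + L3_ad v * L3_ad (L3_bracket w u)"
  by (simp add: algebra_simps flip: ad_commutator)

lemma formanek_value_ad_product:
  fixes u v1 v2 v3 v4 :: "'a::field ^ 3"
  defines "a \<equiv> L3_bracket v1 u" and "b \<equiv> L3_bracket v2 u"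
    and "p \<equiv> L3_bracket v3 u" and "q \<equiv> L3_bracket v4 u"
  shows "formanek_value (L3_ad u) (L3_ad v1) (L3_ad v2) (L3_ad v3 * L3_ad v4) =
    endo_scale (- 2 * dot u u * (dot a p * dot b q + dot a q * dot b p - dot a b * dot p q)) 1"
proof (rule endo_eqI)
  fix w
  show "endo_apply (formanek_value (L3_ad u) (L3_ad v1) (L3_ad v2) (L3_ad v3 * L3_ad v4)) w =
    endo_apply (endo_scale
      (- 2 * dot u u * (dot a p * dot b q + dot a q * dot b p - dot a b * dot p q)) 1) w"
    unfolding formanek_value_def formanek_term_def Let_def assms ad_commutator ad_commutator_product
      endo_apply_simps endo_apply_ad L3_coordinates dot_def
    by (intro conjI; algebra)
qed

section \<open>Scalars in the center of M(L3)\<close>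

lemma subalgebra_M_L3: "endo.subalgebra M_L3"
  unfolding M_L3_def endo.generated_subalgebra_def
  by (rule hull_in) (auto simp: endo.subalgebra_def intro: endo.subspace_Inter)

text \<open>\<open>M_L3\<close> is generated without a unit, so a scalar operator must be shown to
  lie in it before it can be central.\<close>

lemma one_in_M_L3:
  assumes "(2 :: 'a::field) \<noteq> 0"
  shows "(1 :: ('a, 3) endo) \<in> M_L3"
proof -
  have sub: "endo.subalgebra (M_L3 :: ('a, 3) endo set)"
    by (rule subalgebra_M_L3)
  have sq: "L3_ad v * L3_ad v \<in> M_L3" for v :: "'a ^ 3"
    using sub hull_subset[of R_L3 endo.subalgebra]
    by (auto simp: endo.subalgebra_def M_L3_def endo.generated_subalgebra_def R_L3_eq)
  \<comment> \<open>The Casimir operator: the squares of ad e, ad f, ad g add up to -2 times the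
    identity.\<close>
  have "(1 :: ('a, 3) endo) =
      endo_scale (- inverse 2) (\<Sum>i\<in>UNIV. L3_ad (axis i 1) * L3_ad (axis i 1))"
    using assms by (intro endo_eqI) (simp add: L3_coordinates sum_3 axis_def field_simps)
  also have "\<dots> \<in> M_L3"
    using sub unfolding endo.subalgebra_def
    by (intro endo.subspace_scale endo.subspace_sum sq) simp_all
  finally show ?thesis .
qed

lemma scalar_in_center:
  assumes "(2 :: 'a::field) \<noteq> 0"
  shows "endo_scale c 1 \<in> center_of (M_L3 :: ('a, 3) endo set)"
proof -
  have "endo.subspace (M_L3 :: ('a, 3) endo set)"
    using subalgebra_M_L3 unfolding endo.subalgebra_def by blast
  then have "endo_scale c 1 \<in> (M_L3 :: ('a, 3) endo set)"
    using one_in_M_L3[OF assms] by (rule endo.subspace_scale)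
  then show ?thesis
    by (simp add: center_of_def endo.scale_mult_left endo.scale_mult_right)
qed

text \<open>For u = e and all other vectors f, the four brackets equal [f,e] = -g, so the form is 1
  + 1 - 1 = 1 and the scalar is -2. Applying the operator to e and taking the first coordinate reads
  it off.\<close>

lemma formanek_value_ad_product_nonzero:
  assumes "(2 :: 'a::field) \<noteq> 0"
  defines "A \<equiv> L3_ad (axis 1 1) :: ('a, 3) endo" and "B \<equiv> L3_ad (axis 2 1)"
  shows "formanek_value A B B (B * B) \<noteq> 0"
proof
  assume "formanek_value A B B (B * B) = 0"
  then have "endo_apply (formanek_value A B B (B * B)) (axis 1 1) $ 1 = 0"
    by simp
  then show False
    using assms(1) unfolding assms(2,3) formanek_value_ad_product
    by (simp add: dot_def L3_bracket_def axis_def)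
qed

theorem mainTheorem7:
  assumes "CHAR('a::field) \<noteq> 2"
  shows "(\<forall>u\<in>R_L3. \<forall>v1\<in>R_L3. \<forall>v2\<in>R_L3. \<forall>v3\<in>R_L3.
            endo.eval (assign u v1 v2 v3) (formanek_c :: (var4, 'a) free_algebra) = 0)
       \<and> endo.weak_central_polynomial M_L3 R_L3 (formanek_c_subst :: (var5, 'a) free_algebra)
       \<and> free_degree (formanek_c_subst :: (var5, 'a) free_algebra) = 10"
proof -
  have "CHAR('a) \<noteq> 1"
    by simp
  \<comment> \<open>The only divisors of 2 are 1 and 2; characteristic 0 does not divide 2.\<close>
  then have "\<not> CHAR('a) dvd 2"
    using assms dvd_imp_le[of "CHAR('a)" 2] by (cases "CHAR('a)" rule: nat.exhaust) auto
  then have two: "(2 :: 'a) \<noteq> 0"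
    using of_nat_eq_0_iff_char_dvd[where ?'a = 'a, of 2] by simp
  define A B :: "('a, 3) endo" where "A = L3_ad (axis 1 1)" and "B = L3_ad (axis 2 1)"
  define \<phi> where "\<phi> = (\<lambda>v. if v = X' then A else B)"
  have nonzero: "endo.eval \<phi> formanek_c_subst \<noteq> 0"
    using formanek_value_ad_product_nonzero[OF two]
    by (simp add: endo.eval_formanek_c_subst \<phi>_def A_def B_def)
  have "range \<phi> \<subseteq> R_L3"
    by (auto simp: \<phi>_def A_def B_def R_L3_eq)
  moreover have "endo.eval \<psi> (formanek_c_subst :: (var5, 'a) free_algebra) \<in> center_of M_L3"
    if \<psi>: "range \<psi> \<subseteq> R_L3" for \<psi>
  proof -
    have "\<forall>v. \<exists>w. \<psi> v = L3_ad w"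
      using \<psi> by (auto simp: R_L3_eq)
    then obtain w where "\<And>v. \<psi> v = L3_ad (w v)"
      by metis
    then show ?thesis
      by (simp only: endo.eval_formanek_c_subst formanek_value_ad_product scalar_in_center[OF two])
  qed
  ultimately have "endo.weak_central_polynomial M_L3 R_L3
      (formanek_c_subst :: (var5, 'a) free_algebra)"
    using nonzero unfolding endo.weak_central_polynomial_def by blast
  moreover have "free_degree (formanek_c_subst :: (var5, 'a) free_algebra) = 10"
    \<comment> \<open>A nonzero value shows that the polynomial is nonzero, so homogeneity fixes its
      degree.\<close>
    using nonzero homogeneous_formanek_c_subst by (intro homogeneous_imp_free_degree) auto
  ultimately show ?thesis
    by (auto simp: R_L3_eq endo.eval_formanek_c formanek_value_ad)
qed

end
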